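(* Assume that $(\xi_j:j\ge 0)$ is a sequence of i.i.d. random variables for which there exist positive constants $d$ and $\nu$ such that $\mathbb{P}(\xi_j>x)\sim d\exp(-\nu x)$ as $x\to\infty$. Suppose also that $(X_j:j\ge 1)$ is a sequence of i.i.d. random variables, independent of $(\xi_j:j\ge 0)$, for which $\mathbb{E}\exp(\nu X_1)<1$. Let $S_0=0$, $S_n=X_1+\cdots+X_n$ for $n\ge 1$, and $M_\infty=\max\{S_k+\xi_k:k\ge 0\}$. Then $$\mathbb{P}(M_\infty>x)\sim d\,(1-\mathbb{E}\exp(\nu X_1))^{-1}\exp(-\nu x)\qquad\text{as } x\to\infty.$$
   Context: All random variables are real-valued. $f(x)\sim g(x)$ as $x\to\infty$ means $f(x)/g(x)\to 1$. *)

theory Defs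
  imports "HOL-Probability.Probability" "HOL-Library.Landau_Symbols"
begin

definition iid :: "'a measure \<Rightarrow> nat set \<Rightarrow> (nat \<Rightarrow> 'a \<Rightarrow> real) \<Rightarrow> bool" where
  "iid M I Y \<longleftrightarrow>
     prob_space.indep_vars M (\<lambda>_. borel) Y I \<and>
     (\<forall>i\<in>I. \<forall>j\<in>I. distr M borel (Y i) = distr M borel (Y j))"

text \<open>Independence of two whole sequences, as random elements of the product spaces.
  It does not include any independence within either sequence.\<close>

definition indep_sequences ::
    "'a measure \<Rightarrow> nat set \<Rightarrow> (nat \<Rightarrow> 'a \<Rightarrow> real) \<Rightarrow> nat set \<Rightarrow> (nat \<Rightarrow> 'a \<Rightarrow> real) \<Rightarrow> bool" where
  "indep_sequences M I Y J Z \<longleftrightarrow>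
     prob_space.indep_var M
       (PiM I (\<lambda>_. borel)) (\<lambda>\<omega>. \<lambda>i\<in>I. Y i \<omega>)
       (PiM J (\<lambda>_. borel)) (\<lambda>\<omega>. \<lambda>j\<in>J. Z j \<omega>)"

definition walk :: "(nat \<Rightarrow> 'a \<Rightarrow> real) \<Rightarrow> nat \<Rightarrow> 'a \<Rightarrow> real" where
  "walk X n \<omega> = (\<Sum>j=1..n. X j \<omega>)"

text \<open>The maximum of the perturbed walk is taken as a supremum in the extended reals, so that
  it is defined at every outcome. That it is almost surely attained, hence a genuine maximum,
  is a separate claim.\<close>

definition perturbed_max :: "(nat \<Rightarrow> 'a \<Rightarrow> real) \<Rightarrow> (nat \<Rightarrow> 'a \<Rightarrow> real) \<Rightarrow> 'a \<Rightarrow> ereal" where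
  "perturbed_max X \<xi> \<omega> = (SUP k. ereal (walk X k \<omega> + \<xi> k \<omega>))"

end

theory Submission
  imports Defs "HOL-Real_Asymp.Real_Asymp"
begin

text \<open>
  Let \<open>A\<^sub>k(x)\<close> be the event \<open>S\<^sub>k + \<xi>\<^sub>k > x\<close>, \<open>F\<close> the common tail of the \<open>\<xi>\<^sub>k\<close> and
  \<open>\<rho> = E exp(\<nu>X\<^sub>1)\<close>. Conditioning on the walk gives
  \<open>exp(\<nu>x) P(A\<^sub>k(x)) = E[exp(\<nu>S\<^sub>k) G(x - S\<^sub>k)]\<close> with \<open>G(y) = exp(\<nu>y) F(y)\<close>, and
  \<open>G\<close> is bounded by some \<open>C\<close> and tends to \<open>d\<close>. By dominated convergence this tends to \<open>d \<rho>\<^sup>k\<close>, and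
  it is at most \<open>C \<rho>\<^sup>k\<close>, so the union bound and Tannery's theorem give the upper estimate
  \<open>d / (1 - \<rho>)\<close>. For \<open>j < k\<close> the same conditioning bounds \<open>exp(\<nu>x) P(A\<^sub>j(x) \<inter> A\<^sub>k(x))\<close> by
  \<open>E[C exp(\<nu>S\<^sub>j) F(x - S\<^sub>k)]\<close>, which vanishes in the limit, so
  Bonferroni's inequality for the first \<open>n\<close> events gives the matching lower estimate as \<open>n \<rightarrow> \<infinity>\<close>.
  Almost sure attainment of the supremum is Borel--Cantelli.
\<close>

section \<open>Two general probability estimates: sections and Bonferroni\<close>

text \<open>Independence makes the joint law of \<open>U\<close> and \<open>V\<close> the product of
  their laws, so Fubini applies to \<open>Q\<close>. This is conditioning on \<open>V\<close>: its
  value is frozen while \<open>U\<close> stays random.\<close>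

lemma (in prob_space) prob_indep_var_section:
  assumes "indep_var S U T V" and Q: "Q \<in> sets (S \<Otimes>\<^sub>M T)"
  shows "prob {\<omega> \<in> space M. (U \<omega>, V \<omega>) \<in> Q} =
    (\<integral>\<omega>. prob {\<omega>' \<in> space M. (U \<omega>', V \<omega>) \<in> Q} \<partial>M)"
proof -
  have [measurable]: "random_variable S U" "random_variable T V"
    and eq: "distr M S U \<Otimes>\<^sub>M distr M T V = distr M (S \<Otimes>\<^sub>M T) (\<lambda>\<omega>. (U \<omega>, V \<omega>))"
    using assms(1) by (simp_all add: indep_var_distribution_eq)
  note [measurable] = Q
  interpret U: prob_space "distr M S U" by (rule prob_space_distr) simp
  interpret V: prob_space "distr M T V" by (rule prob_space_distr) simp
  interpret UV: pair_prob_space "distr M S U" "distr M T V" ..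
  have section_eq: "emeasure (distr M S U) ((\<lambda>u. (u, V \<omega>)) -` Q) =
      ennreal (prob {\<omega>' \<in> space M. (U \<omega>', V \<omega>) \<in> Q})" for \<omega>
  proof -
    have "(\<lambda>u. (u, V \<omega>)) -` Q \<in> sets S"
      using Q by (rule sets_Pair2)
    thus ?thesis
      by (subst emeasure_distr)
        (auto simp: emeasure_eq_measure intro!: arg_cong[where f = prob])
  qed
  have "ennreal (prob {\<omega> \<in> space M. (U \<omega>, V \<omega>) \<in> Q}) =
      emeasure (distr M (S \<Otimes>\<^sub>M T) (\<lambda>\<omega>. (U \<omega>, V \<omega>))) Q"
    by (subst emeasure_distr)
      (auto simp: emeasure_eq_measure intro!: arg_cong[where f = prob])
  also have "\<dots> = (\<integral>\<^sup>+ v. emeasure (distr M S U) ((\<lambda>u. (u, v)) -` Q) \<partial>distr M T V)"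
    unfolding eq[symmetric] using Q by (intro UV.emeasure_pair_measure_alt2) simp
  also have "\<dots> = (\<integral>\<^sup>+ \<omega>. emeasure (distr M S U) ((\<lambda>u. (u, V \<omega>)) -` Q) \<partial>M)"
  proof (rule nn_integral_distr)
    have "Q \<in> sets (distr M S U \<Otimes>\<^sub>M distr M T V)"
      using Q by simp
    from UV.measurable_emeasure_Pair2[OF this]
    show "(\<lambda>v. emeasure (distr M S U) ((\<lambda>u. (u, v)) -` Q)) \<in> borel_measurable (distr M T V)" .
  qed simp
  also have "\<dots> = (\<integral>\<^sup>+ \<omega>. ennreal (prob {\<omega>' \<in> space M. (U \<omega>', V \<omega>) \<in> Q}) \<partial>M)"
    by (intro nn_integral_cong section_eq)
  finally have nn: "ennreal (prob {\<omega> \<in> space M. (U \<omega>, V \<omega>) \<in> Q}) =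
      (\<integral>\<^sup>+ \<omega>. ennreal (prob {\<omega>' \<in> space M. (U \<omega>', V \<omega>) \<in> Q}) \<partial>M)" .
  have "(\<lambda>\<omega>. prob {\<omega>' \<in> space M. (U \<omega>', V \<omega>) \<in> Q}) \<in> borel_measurable M"
  proof -
    \<comment> \<open>The sections are those of one set measurable jointly in
      \<open>\<omega>\<close> and \<open>\<omega>'\<close>. The resulting measurability allows the
      passage from the nonnegative integral to the Bochner integral.\<close>
    have "(\<lambda>\<omega>. prob {\<omega>' \<in> space M. (U \<omega>', V \<omega>) \<in> Q}) =
        (\<lambda>\<omega>. measure M {\<omega>' \<in> space M. (\<lambda>(\<omega>, \<omega>'). (U \<omega>', V \<omega>) \<in> Q) (\<omega>, \<omega>')})"
      by simp
    also have "\<dots> \<in> borel_measurable M"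
      by measurable
    finally show ?thesis .
  qed
  thus ?thesis
    by (subst integral_eq_nn_integral) (simp_all flip: nn)
qed

text \<open>By induction: adjoining \<open>A n\<close> contributes its measure minus that of its
  overlap with the earlier union, and the overlap is controlled by the union bound.\<close>

lemma (in finite_measure) bonferroni_lower:
  fixes A :: "nat \<Rightarrow> 'a set"
  assumes [measurable]: "\<And>k. A k \<in> sets M"
  shows "(\<Sum>k<n. measure M (A k)) - (\<Sum>k<n. \<Sum>j<k. measure M (A j \<inter> A k)) \<le> measure M (\<Union>k<n. A k)"
proof (induction n)
  case (Suc n)
  have "measure M ((\<Union>k<n. A k) \<inter> A n) \<le> (\<Sum>j<n. measure M (A j \<inter> A n))"
    unfolding UN_extend_simps by (intro finite_measure_subadditive_finite) auto
  moreover have "measure M (\<Union>k<Suc n. A k) =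
      measure M (\<Union>k<n. A k) + measure M (A n) - measure M ((\<Union>k<n. A k) \<inter> A n)"
    by (simp add: lessThan_Suc Un_commute[of "A n"] measure_Un3 fmeasurable_eq_sets)
  ultimately show ?case
    using Suc by simp
qed simp

section \<open>Analysis of an exponentially decaying tail function\<close>

locale exponential_tail =
  fixes F :: "real \<Rightarrow> real" and d \<nu> :: real
  assumes nonneg: "F x \<ge> 0" and le_1: "F x \<le> 1"
    and antimono: "antimono F"
    and \<nu>_pos: "\<nu> > 0"
    and scaled_tendsto: "((\<lambda>x. exp (\<nu> * x) * F x) \<longlongrightarrow> d) at_top"
begin

lemma measurable_F [measurable]: "F \<in> borel_measurable borel"
proof -
  have "(\<lambda>x. - F x) \<in> borel_measurable borel"
    using antimono by (intro borel_measurable_mono) (auto simp: mono_def antimono_def)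
  thus ?thesis
    by simp
qed

lemma tendsto_0: "(F \<longlongrightarrow> 0) at_top"
proof -
  have "((\<lambda>x. exp (- (\<nu> * x)) * (exp (\<nu> * x) * F x)) \<longlongrightarrow> 0 * d) at_top"
    using \<nu>_pos by (intro tendsto_mult scaled_tendsto) real_asymp
  thus ?thesis
    by (simp add: mult.assoc[symmetric] exp_add[symmetric])
qed

text \<open>Convergence gives a bound beyond some \<open>b\<close>; below \<open>b\<close> the bound
  \<open>F x \<le> 1\<close> leaves at most \<open>exp (\<nu> * b)\<close>.\<close>

lemma scaled_bounded: "\<exists>C \<ge> 0. \<forall>x. exp (\<nu> * x) * F x \<le> C"
proof -
  have "eventually (\<lambda>x. exp (\<nu> * x) * F x < d + 1) at_top"
    by (rule order_tendstoD(2)[OF scaled_tendsto]) simp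
  then obtain b where b: "exp (\<nu> * x) * F x < d + 1" if "x \<ge> b" for x
    by (auto simp: eventually_at_top_linorder)
  have "exp (\<nu> * x) * F x \<le> max (d + 1) (exp (\<nu> * b))" for x
  proof (cases "x \<ge> b")
    case False
    hence "exp (\<nu> * x) * F x \<le> exp (\<nu> * b) * 1"
      using \<nu>_pos by (intro mult_mono le_1 nonneg) auto
    thus ?thesis by simp
  qed (use b[of x] in auto)
  thus ?thesis
    by (intro exI[of _ "max (d + 1) (exp (\<nu> * b))"]) (auto simp: le_max_iff_disj)
qed

text \<open>Choosing the constant once lets all dominations below share the same factor.\<close>

definition tail_bound :: real where
  "tail_bound = (SOME C. C \<ge> 0 \<and> (\<forall>x. exp (\<nu> * x) * F x \<le> C))"

lemma tail_bound_nonneg: "tail_bound \<ge> 0"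
  and scaled_le: "exp (\<nu> * x) * F x \<le> tail_bound"
  using someI_ex[OF scaled_bounded] by (auto simp: tail_bound_def)

text \<open>Splitting off \<open>exp (\<nu> * w)\<close> from \<open>exp (\<nu> * x)\<close> gives a
  bound free of \<open>x\<close>, fit to dominate integrals over a random shift
  \<open>w\<close>.\<close>

lemma scaled_shift_le: "exp (\<nu> * x) * F (x - w) \<le> tail_bound * exp (\<nu> * w)"
proof -
  have "exp (\<nu> * x) * F (x - w) = (exp (\<nu> * (x - w)) * F (x - w)) * exp (\<nu> * w)"
    by (simp add: algebra_simps flip: exp_add)
  also have "\<dots> \<le> tail_bound * exp (\<nu> * w)"
    by (intro mult_right_mono scaled_le) simp
  finally show ?thesis .
qed

lemma filterlim_shift: "filterlim (\<lambda>x. x - w) at_top at_top" for w :: real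
  by real_asymp

lemma scaled_shift_tendsto: "((\<lambda>x. exp (\<nu> * x) * F (x - w)) \<longlongrightarrow> d * exp (\<nu> * w)) at_top"
proof -
  have "((\<lambda>x. (exp (\<nu> * (x - w)) * F (x - w)) * exp (\<nu> * w)) \<longlongrightarrow> d * exp (\<nu> * w)) at_top"
    by (intro tendsto_mult tendsto_const filterlim_compose[OF scaled_tendsto filterlim_shift])
  also have "(\<lambda>x. (exp (\<nu> * (x - w)) * F (x - w)) * exp (\<nu> * w)) = (\<lambda>x. exp (\<nu> * x) * F (x - w))"
    by (simp add: algebra_simps flip: exp_add)
  finally show ?thesis .
qed

section \<open>Expectations of the tail function at a random shift\<close>

context
  fixes M :: "'a measure" and W :: "'a \<Rightarrow> real"
  assumes prob_space_M: "prob_space M"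
    and W_measurable [measurable]: "W \<in> borel_measurable M"
    and exp_W_integrable: "integrable M (\<lambda>\<omega>. exp (\<nu> * W \<omega>))"
begin

interpretation prob_space M by (fact prob_space_M)

lemma expectation_scaled_tail_tendsto:
  "((\<lambda>x. exp (\<nu> * x) * (\<integral>\<omega>. F (x - W \<omega>) \<partial>M)) \<longlongrightarrow> d * (\<integral>\<omega>. exp (\<nu> * W \<omega>) \<partial>M)) at_top"
proof -
  have "((\<lambda>x. \<integral>\<omega>. exp (\<nu> * x) * F (x - W \<omega>) \<partial>M) \<longlongrightarrow> (\<integral>\<omega>. d * exp (\<nu> * W \<omega>) \<partial>M)) at_top"
  proof (rule integral_dominated_convergence_at_top)
    show "integrable M (\<lambda>\<omega>. tail_bound * exp (\<nu> * W \<omega>))"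
      using exp_W_integrable by simp
  qed (auto simp: scaled_shift_tendsto scaled_shift_le nonneg)
  thus ?thesis by simp
qed

lemma expectation_scaled_tail_le:
  "exp (\<nu> * x) * (\<integral>\<omega>. F (x - W \<omega>) \<partial>M) \<le> tail_bound * (\<integral>\<omega>. exp (\<nu> * W \<omega>) \<partial>M)"
proof -
  have "integrable M (\<lambda>\<omega>. F (x - W \<omega>))"
    by (intro integrable_const_bound[of _ 1]) (auto simp: nonneg le_1)
  hence "(\<integral>\<omega>. exp (\<nu> * x) * F (x - W \<omega>) \<partial>M) \<le> (\<integral>\<omega>. tail_bound * exp (\<nu> * W \<omega>) \<partial>M)"
    using exp_W_integrable by (intro integral_mono) (auto simp: scaled_shift_le)
  thus ?thesis by simp
qed

text \<open>One factor \<open>F\<close> absorbs \<open>exp (\<nu> * x)\<close> and stays bounded,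
  while the other still tends to 0. This makes joint exceedances negligible.\<close>

lemma expectation_scaled_tail_mult_tendsto_0:
  assumes [measurable]: "V \<in> borel_measurable M"
  shows "((\<lambda>x. exp (\<nu> * x) * (\<integral>\<omega>. F (x - W \<omega>) * F (x - V \<omega>) \<partial>M)) \<longlongrightarrow> 0) at_top"
proof -
  have "((\<lambda>x. \<integral>\<omega>. exp (\<nu> * x) * F (x - W \<omega>) * F (x - V \<omega>) \<partial>M) \<longlongrightarrow> (\<integral>\<omega>. 0 \<partial>M)) at_top"
  proof (rule integral_dominated_convergence_at_top)
    show "integrable M (\<lambda>\<omega>. tail_bound * exp (\<nu> * W \<omega>))"
      using exp_W_integrable by simp
    show "\<forall>\<^sub>F x in at_top. AE \<omega> in M. norm (exp (\<nu> * x) * F (x - W \<omega>) * F (x - V \<omega>)) \<le>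
        tail_bound * exp (\<nu> * W \<omega>)"
    proof (intro always_eventually allI AE_I2)
      fix x \<omega>
      \<comment> \<open>For domination the second factor is bounded by 1 only, so no exponential
        moment of \<open>V\<close> enters.\<close>
      have "exp (\<nu> * x) * F (x - W \<omega>) * F (x - V \<omega>) \<le> tail_bound * exp (\<nu> * W \<omega>) * 1"
        by (intro mult_mono scaled_shift_le le_1 nonneg) (auto simp: tail_bound_nonneg)
      thus "norm (exp (\<nu> * x) * F (x - W \<omega>) * F (x - V \<omega>)) \<le> tail_bound * exp (\<nu> * W \<omega>)"
        by (simp add: nonneg)
    qed
    show "AE \<omega> in M. ((\<lambda>x. exp (\<nu> * x) * F (x - W \<omega>) * F (x - V \<omega>)) \<longlongrightarrow> 0) at_top"
    proof (intro AE_I2)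
      fix \<omega>
      show "((\<lambda>x. exp (\<nu> * x) * F (x - W \<omega>) * F (x - V \<omega>)) \<longlongrightarrow> 0) at_top"
        using tendsto_mult[OF scaled_shift_tendsto[of "W \<omega>"]
            filterlim_compose[OF tendsto_0 filterlim_shift[of "V \<omega>"]]] by simp
    qed
  qed auto
  thus ?thesis by (simp add: mult.assoc)
qed

end

end

section \<open>The perturbed walk: independence and exponential moments\<close>

text \<open>Integrability is a separate assumption because the Bochner integral of a non-integrable
  function is 0, so \<open>\<rho>_less_1\<close> alone would admit an infinite expectation. The tail
  is prescribed at index 0 and carried to the others by identical distribution.\<close>

locale perturbed_walk = prob_space M
  for M :: "'a measure" and \<xi> X :: "nat \<Rightarrow> 'a \<Rightarrow> real" and d \<nu> :: real +
  assumes \<nu>_pos: "\<nu> > 0"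
    and iid_\<xi>: "iid M UNIV \<xi>"
    and tail_equiv: "(\<lambda>x. prob {\<omega> \<in> space M. \<xi> 0 \<omega> > x}) \<sim>[at_top] (\<lambda>x. d * exp (- \<nu> * x))"
    and iid_X: "iid M {1..} X"
    and indep_\<xi>_X: "indep_sequences M UNIV \<xi> {1..} X"
    and exp_X_integrable: "integrable M (\<lambda>\<omega>. exp (\<nu> * X 1 \<omega>))"
    and \<rho>_less_1: "(\<integral>\<omega>. exp (\<nu> * X 1 \<omega>) \<partial>M) < 1"
begin

definition F :: "real \<Rightarrow> real" where
  "F x = prob {\<omega> \<in> space M. \<xi> 0 \<omega> > x}"

definition \<rho> :: real where
  "\<rho> = (\<integral>\<omega>. exp (\<nu> * X 1 \<omega>) \<partial>M)"

lemma \<rho>_nonneg: "\<rho> \<ge> 0"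
  unfolding \<rho>_def by (intro Bochner_Integration.integral_nonneg) simp

lemma indep_vars_\<xi>: "indep_vars (\<lambda>_. borel) \<xi> UNIV"
  using iid_\<xi> unfolding iid_def by blast

lemma indep_vars_X: "indep_vars (\<lambda>_. borel) X {1..}"
  using iid_X unfolding iid_def by blast

lemma measurable_\<xi> [measurable]: "random_variable borel (\<xi> k)"
  using indep_vars_\<xi> by (simp add: indep_vars_def)

lemma measurable_X: "j \<ge> 1 \<Longrightarrow> random_variable borel (X j)"
  using indep_vars_X by (simp add: indep_vars_def)

lemma measurable_walk [measurable]: "random_variable borel (walk X k)"
  unfolding walk_def by (intro borel_measurable_sum measurable_X) simp

lemma prob_\<xi>_greater: "prob {\<omega> \<in> space M. \<xi> k \<omega> > x} = F x"
proof -
  have "prob {\<omega> \<in> space M. \<xi> k \<omega> > x} = measure (distr M borel (\<xi> k)) {x<..}" for k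
    by (subst measure_distr) (auto intro!: arg_cong[where f = prob])
  moreover have "distr M borel (\<xi> k) = distr M borel (\<xi> 0)"
    using iid_\<xi> unfolding iid_def by blast
  ultimately show ?thesis
    by (simp add: F_def)
qed

lemma prob_\<xi>_pair_greater:
  assumes "j \<noteq> k"
  shows "prob {\<omega> \<in> space M. \<xi> j \<omega> > x \<and> \<xi> k \<omega> > y} = F x * F y"
proof -
  have "indep_vars (\<lambda>_. borel) \<xi> {j, k}"
    by (rule indep_vars_subset[OF indep_vars_\<xi>]) simp
  from indep_varsD[OF this, of "{j, k}" "\<lambda>i. if i = j then {x<..} else {y<..}"] assms
  have "prob (\<xi> j -` {x<..} \<inter> space M \<inter> (\<xi> k -` {y<..} \<inter> space M)) =
      prob (\<xi> j -` {x<..} \<inter> space M) * prob (\<xi> k -` {y<..} \<inter> space M)"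
    by (auto split: if_splits)
  also have "\<xi> j -` {x<..} \<inter> space M \<inter> (\<xi> k -` {y<..} \<inter> space M) =
      {\<omega> \<in> space M. \<xi> j \<omega> > x \<and> \<xi> k \<omega> > y}"
    by auto
  also have "\<xi> j -` {x<..} \<inter> space M = {\<omega> \<in> space M. \<xi> j \<omega> > x}"
    by auto
  also have "\<xi> k -` {y<..} \<inter> space M = {\<omega> \<in> space M. \<xi> k \<omega> > y}"
    by auto
  finally show ?thesis
    by (simp add: prob_\<xi>_greater)
qed

text \<open>Multiplying the asymptotic equivalence by \<open>exp (\<nu> * x)\<close> turns its right
  side into the constant \<open>d\<close>, and equivalent functions have the same limits.\<close>

sublocale tail: exponential_tail F d \<nu>
proof
  show "antimono F"
    unfolding antimono_def F_def by (auto intro!: finite_measure_mono)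
  have "(\<lambda>x. exp (\<nu> * x) * F x) \<sim>[at_top] (\<lambda>x. exp (\<nu> * x) * (d * exp (- \<nu> * x)))"
    using tail_equiv by (intro asymp_equiv_mult asymp_equiv_refl) (simp add: F_def)
  also have "(\<lambda>x. exp (\<nu> * x) * (d * exp (- \<nu> * x))) = (\<lambda>x. d)"
    by (simp add: mult.left_commute[of _ d] flip: exp_add)
  finally show "((\<lambda>x. exp (\<nu> * x) * F x) \<longlongrightarrow> d) at_top"
    by (rule tendsto_asymp_equiv_cong[THEN iffD2]) simp
qed (simp_all add: F_def \<nu>_pos)

lemma exp_walk: "exp (\<nu> * walk X k \<omega>) = (\<Prod>j=1..k. exp (\<nu> * X j \<omega>))"
  unfolding walk_def sum_distrib_left by (rule exp_sum) simp

text \<open>The exponential turns the walk into a product of \<open>k\<close> independent integrable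
  factors with common mean \<open>\<rho>\<close>.\<close>

lemma exp_walk_integrable: "integrable M (\<lambda>\<omega>. exp (\<nu> * walk X k \<omega>))"
  and expectation_exp_walk: "(\<integral>\<omega>. exp (\<nu> * walk X k \<omega>) \<partial>M) = \<rho> ^ k"
proof -
  have "indep_vars (\<lambda>_. borel) X {1..k}"
    by (rule indep_vars_subset[OF indep_vars_X]) auto
  hence indep: "indep_vars (\<lambda>_. borel) (\<lambda>j \<omega>. exp (\<nu> * X j \<omega>)) {1..k}"
    by (rule indep_vars_compose2) simp
  have same: "integrable M (\<lambda>\<omega>. exp (\<nu> * X j \<omega>)) \<and> (\<integral>\<omega>. exp (\<nu> * X j \<omega>) \<partial>M) = \<rho>"
    if "j \<ge> 1" for j
  proof -
    have [measurable]: "random_variable borel (X j)" "random_variable borel (X 1)"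
      using that by (auto intro: measurable_X)
    have distr: "distr M borel (X j) = distr M borel (X 1)"
      using iid_X that unfolding iid_def by (metis atLeast_iff order_refl)
    have "integrable M (\<lambda>\<omega>. exp (\<nu> * X j \<omega>)) \<longleftrightarrow>
        integrable (distr M borel (X j)) (\<lambda>x. exp (\<nu> * x))"
      by (subst integrable_distr_eq) auto
    also have "\<dots> \<longleftrightarrow> integrable M (\<lambda>\<omega>. exp (\<nu> * X 1 \<omega>))"
      unfolding distr by (subst integrable_distr_eq) (simp_all del: One_nat_def)
    finally have "integrable M (\<lambda>\<omega>. exp (\<nu> * X j \<omega>))"
      using exp_X_integrable by simp
    moreover have "(\<integral>\<omega>. exp (\<nu> * X j \<omega>) \<partial>M) = (\<integral>x. exp (\<nu> * x) \<partial>distr M borel (X j))"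
      by (subst integral_distr) auto
    moreover have "(\<integral>x. exp (\<nu> * x) \<partial>distr M borel (X j)) = \<rho>"
      unfolding distr \<rho>_def by (subst integral_distr) (simp_all del: One_nat_def)
    ultimately show ?thesis by simp
  qed
  show "integrable M (\<lambda>\<omega>. exp (\<nu> * walk X k \<omega>))"
    unfolding exp_walk using same by (intro indep_vars_integrable indep) auto
  have "(\<integral>\<omega>. exp (\<nu> * walk X k \<omega>) \<partial>M) = (\<Prod>j=1..k. \<integral>\<omega>. exp (\<nu> * X j \<omega>) \<partial>M)"
    unfolding exp_walk using same by (intro indep_vars_lebesgue_integral indep) auto
  thus "(\<integral>\<omega>. exp (\<nu> * walk X k \<omega>) \<partial>M) = \<rho> ^ k"
    using same by simp
qed

text \<open>Evaluation at two indices and partial sums are measurable maps of the two sequences, so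
  independence passes to the images. Equal indices serve single events, distinct ones serve
  intersections.\<close>

lemma indep_var_\<xi>_walk:
  "indep_var (borel \<Otimes>\<^sub>M borel) (\<lambda>\<omega>. (\<xi> j \<omega>, \<xi> k \<omega>))
     (borel \<Otimes>\<^sub>M borel) (\<lambda>\<omega>. (walk X j \<omega>, walk X k \<omega>))"
proof -
  have "(\<lambda>f. \<Sum>i=1..n. f i) \<in> borel_measurable (\<Pi>\<^sub>M i\<in>{1..}. (borel :: real measure))" for n :: nat
    by (intro borel_measurable_sum measurable_component_singleton) simp
  hence "indep_var (borel \<Otimes>\<^sub>M borel) ((\<lambda>f. (f j, f k)) \<circ> (\<lambda>\<omega>. \<lambda>i\<in>UNIV. \<xi> i \<omega>))
     (borel \<Otimes>\<^sub>M borel) ((\<lambda>f. (\<Sum>i=1..j. f i, \<Sum>i=1..k. f i)) \<circ> (\<lambda>\<omega>. \<lambda>i\<in>{1..}. X i \<omega>))"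
    by (intro indep_var_compose[OF indep_\<xi>_X[unfolded indep_sequences_def]] measurable_Pair) auto
  thus ?thesis
    by (simp add: comp_def walk_def)
qed

section \<open>Exceedance events and their scaled probabilities\<close>

definition exceeds :: "nat \<Rightarrow> real \<Rightarrow> 'a set" where
  "exceeds k x = {\<omega> \<in> space M. walk X k \<omega> + \<xi> k \<omega> > x}"

lemma exceeds_event [measurable]: "exceeds k x \<in> events"
  unfolding exceeds_def by measurable

lemma prob_exceeds: "prob (exceeds k x) = (\<integral>\<omega>. F (x - walk X k \<omega>) \<partial>M)"
proof -
  \<comment> \<open>The first component of \<open>p\<close> holds the perturbations and the second
    the walk, so freezing the second leaves a tail event of the perturbation alone.\<close>
  have "{p \<in> space ((borel \<Otimes>\<^sub>M borel) \<Otimes>\<^sub>M (borel \<Otimes>\<^sub>M borel)). fst (snd p) + fst (fst p) > x} \<in>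
      sets ((borel \<Otimes>\<^sub>M borel) \<Otimes>\<^sub>M (borel \<Otimes>\<^sub>M borel :: (real \<times> real) measure))"
    by measurable
  from prob_indep_var_section[OF indep_var_\<xi>_walk this, of k k]
  show ?thesis
    by (simp add: exceeds_def space_pair_measure less_diff_eq diff_less_eq add.commute
        flip: prob_\<xi>_greater[where k = k])
qed

text \<open>With both walk values frozen, the two events concern distinct, hence independent,
  perturbations, so each section probability factors.\<close>

lemma prob_exceeds_Int:
  assumes "j \<noteq> k"
  shows "prob (exceeds j x \<inter> exceeds k x) = (\<integral>\<omega>. F (x - walk X j \<omega>) * F (x - walk X k \<omega>) \<partial>M)"
proof -
  have "{p \<in> space ((borel \<Otimes>\<^sub>M borel) \<Otimes>\<^sub>M (borel \<Otimes>\<^sub>M borel)).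
      fst (snd p) + fst (fst p) > x \<and> snd (snd p) + snd (fst p) > x} \<in>
      sets ((borel \<Otimes>\<^sub>M borel) \<Otimes>\<^sub>M (borel \<Otimes>\<^sub>M borel :: (real \<times> real) measure))"
    by measurable
  from prob_indep_var_section[OF indep_var_\<xi>_walk this, of j k]
  have "prob {\<omega> \<in> space M. walk X j \<omega> + \<xi> j \<omega> > x \<and> walk X k \<omega> + \<xi> k \<omega> > x} =
      (\<integral>\<omega>. F (x - walk X j \<omega>) * F (x - walk X k \<omega>) \<partial>M)"
    by (simp add: space_pair_measure less_diff_eq diff_less_eq add.commute flip: prob_\<xi>_pair_greater[OF assms])
  moreover have "exceeds j x \<inter> exceeds k x =
      {\<omega> \<in> space M. walk X j \<omega> + \<xi> j \<omega> > x \<and> walk X k \<omega> + \<xi> k \<omega> > x}"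
    by (auto simp: exceeds_def)
  ultimately show ?thesis by simp
qed

lemma scaled_prob_exceeds_tendsto:
  "((\<lambda>x. exp (\<nu> * x) * prob (exceeds k x)) \<longlongrightarrow> d * \<rho> ^ k) at_top"
  unfolding prob_exceeds expectation_exp_walk[symmetric]
  by (intro tail.expectation_scaled_tail_tendsto prob_space_axioms measurable_walk exp_walk_integrable)

lemma scaled_prob_exceeds_le: "exp (\<nu> * x) * prob (exceeds k x) \<le> tail.tail_bound * \<rho> ^ k"
  unfolding prob_exceeds expectation_exp_walk[symmetric]
  by (intro tail.expectation_scaled_tail_le prob_space_axioms measurable_walk exp_walk_integrable)

lemma scaled_prob_exceeds_Int_tendsto_0:
  "j \<noteq> k \<Longrightarrow> ((\<lambda>x. exp (\<nu> * x) * prob (exceeds j x \<inter> exceeds k x)) \<longlongrightarrow> 0) at_top"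
  unfolding prob_exceeds_Int
  by (intro tail.expectation_scaled_tail_mult_tendsto_0 prob_space_axioms measurable_walk
      exp_walk_integrable)

text \<open>This majorant is the same for all \<open>x\<close>, as Tannery's theorem requires; at
  fixed \<open>x\<close> it yields the summability behind the union bound and
  Borel-Cantelli.\<close>

lemma summable_tail_bound: "summable (\<lambda>k. tail.tail_bound * \<rho> ^ k)"
  using \<rho>_nonneg \<rho>_less_1 by (intro summable_mult summable_geometric) (simp add: \<rho>_def)

lemma summable_scaled_prob_exceeds: "summable (\<lambda>k. exp (\<nu> * x) * prob (exceeds k x))"
  by (rule summable_comparison_test'[OF summable_tail_bound, of 0])
    (simp add: scaled_prob_exceeds_le)

lemma summable_prob_exceeds: "summable (\<lambda>k. prob (exceeds k x))"
  using summable_scaled_prob_exceeds by (rule summable_mult_D) simp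

section \<open>Tail and attainment of the supremum\<close>

text \<open>The strict inequality matters: a supremum lies strictly above \<open>x\<close> exactly
  when some term does, whether or not it is attained.\<close>

lemma perturbed_max_greater:
  "{\<omega> \<in> space M. perturbed_max X \<xi> \<omega> > ereal x} = (\<Union>k. exceeds k x)"
  by (auto simp: perturbed_max_def exceeds_def less_SUP_iff)

theorem scaled_prob_perturbed_max_tendsto:
  "((\<lambda>x. exp (\<nu> * x) * prob {\<omega> \<in> space M. perturbed_max X \<xi> \<omega> > ereal x}) \<longlongrightarrow>
     d * inverse (1 - \<rho>)) at_top"
proof -
  have "norm \<rho> < 1"
    using \<rho>_nonneg \<rho>_less_1 by (simp add: \<rho>_def)
  hence sums: "(\<lambda>k. d * \<rho> ^ k) sums (d * inverse (1 - \<rho>))"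
    using sums_mult[OF geometric_sums[of \<rho>], of d] by (simp add: inverse_eq_divide)
  have upper: "exp (\<nu> * x) * prob (\<Union>k. exceeds k x) \<le> (\<Sum>k. exp (\<nu> * x) * prob (exceeds k x))" for x
  proof -
    have "prob (\<Union>k. exceeds k x) \<le> (\<Sum>k. prob (exceeds k x))"
      by (intro finite_measure_subadditive_countably summable_prob_exceeds) auto
    thus ?thesis
      by (simp add: suminf_mult[OF summable_prob_exceeds])
  qed
  have upper_lim: "((\<lambda>x. \<Sum>k. exp (\<nu> * x) * prob (exceeds k x)) \<longlongrightarrow> d * inverse (1 - \<rho>)) at_top"
  proof -
    have "((\<lambda>x. \<Sum>k. exp (\<nu> * x) * prob (exceeds k x)) \<longlongrightarrow> (\<Sum>k. d * \<rho> ^ k)) at_top"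
      by (rule tannerys_theorem[OF scaled_prob_exceeds_tendsto _ summable_tail_bound,
            THEN conjunct2, THEN conjunct2])
        (auto intro!: always_eventually simp: scaled_prob_exceeds_le)
    thus ?thesis
      using sums by (simp add: sums_iff)
  qed
  define lower where "lower n x = (\<Sum>k<n. exp (\<nu> * x) * prob (exceeds k x)) -
    (\<Sum>k<n. \<Sum>j<k. exp (\<nu> * x) * prob (exceeds j x \<inter> exceeds k x))" for n x
  have lower: "lower n x \<le> exp (\<nu> * x) * prob (\<Union>k. exceeds k x)" for n x
  proof -
    have "lower n x = exp (\<nu> * x) * ((\<Sum>k<n. prob (exceeds k x)) -
        (\<Sum>k<n. \<Sum>j<k. prob (exceeds j x \<inter> exceeds k x)))"
      by (simp add: lower_def right_diff_distrib sum_distrib_left)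
    also have "\<dots> \<le> exp (\<nu> * x) * prob (\<Union>k<n. exceeds k x)"
      by (intro mult_left_mono bonferroni_lower) auto
    also have "\<dots> \<le> exp (\<nu> * x) * prob (\<Union>k. exceeds k x)"
      by (intro mult_left_mono finite_measure_mono) auto
    finally show ?thesis .
  qed
  have lower_lim: "(lower n \<longlongrightarrow> (\<Sum>k<n. d * \<rho> ^ k)) at_top" for n
  proof -
    \<comment> \<open>For fixed \<open>n\<close> both sums are finite, so limits may be taken
      termwise and every overlap term vanishes.\<close>
    have "(lower n \<longlongrightarrow> (\<Sum>k<n. d * \<rho> ^ k) - (\<Sum>k<n. \<Sum>j<k. 0)) at_top"
      unfolding lower_def
      by (intro tendsto_diff tendsto_sum scaled_prob_exceeds_tendsto
          scaled_prob_exceeds_Int_tendsto_0) auto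
    thus ?thesis by simp
  qed
  show ?thesis
    unfolding perturbed_max_greater
  proof (rule order_tendstoI)
    \<comment> \<open>Here \<open>n\<close> is fixed before \<open>x\<close> grows: some partial sum
      already exceeds \<open>a\<close>, and \<open>lower n\<close> converges to it.\<close>
    fix a assume "a < d * inverse (1 - \<rho>)"
    hence "eventually (\<lambda>n. a < (\<Sum>k<n. d * \<rho> ^ k)) sequentially"
      using sums unfolding sums_def by (rule order_tendstoD(1)[rotated])
    then obtain n where "a < (\<Sum>k<n. d * \<rho> ^ k)"
      by (auto simp: eventually_sequentially)
    from order_tendstoD(1)[OF lower_lim this]
    show "\<forall>\<^sub>F x in at_top. a < exp (\<nu> * x) * prob (\<Union>k. exceeds k x)"
      by eventually_elim (rule less_le_trans[OF _ lower])
  next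
    fix a assume "d * inverse (1 - \<rho>) < a"
    from order_tendstoD(2)[OF upper_lim this]
    show "\<forall>\<^sub>F x in at_top. exp (\<nu> * x) * prob (\<Union>k. exceeds k x) < a"
      by eventually_elim (rule le_less_trans[OF upper])
  qed
qed

text \<open>Almost surely every level is exceeded by finitely many terms only, so the supremum
  reduces to a maximum over finitely many indices.\<close>

theorem AE_perturbed_max_attained:
  "AE \<omega> in M. \<exists>k. perturbed_max X \<xi> \<omega> = ereal (walk X k \<omega> + \<xi> k \<omega>)"
proof -
  \<comment> \<open>Restricting to the countably many levels \<open>- real m\<close> keeps the
    exceptional set null; these levels still reach below any real number.\<close>
  have "AE \<omega> in M. \<forall>m::nat. \<forall>\<^sub>F k in sequentially. \<omega> \<in> space M - exceeds k (- real m)"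
    unfolding AE_all_countable
    by (intro allI borel_cantelli_AE1 summable_prob_exceeds) (auto simp: emeasure_eq_measure)
  thus ?thesis
  proof eventually_elim
    case (elim \<omega>)
    define Y where "Y k = walk X k \<omega> + \<xi> k \<omega>" for k
    \<comment> \<open>The level depends on the outcome: it lies below \<open>Y 0\<close>, so all
      late terms are smaller than \<open>Y 0\<close>.\<close>
    obtain m :: nat where m: "- Y 0 < real m"
      using reals_Archimedean2 by blast
    from elim obtain N where N: "\<omega> \<in> space M - exceeds k (- real m)" if "k \<ge> N" for k
      unfolding eventually_sequentially by blast
    have large: "Y k \<le> Y 0" if "k \<ge> N" for k
      using N[OF that] m by (auto simp: exceeds_def Y_def)
    \<comment> \<open>Index 0 belongs to the range \<open>{..N}\<close>, so this maximum also
      dominates the terms beyond \<open>N\<close> through \<open>Y 0\<close>.\<close>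
    have "Max (Y ` {..N}) \<in> Y ` {..N}"
      by (intro Max_in) auto
    then obtain k where k: "Y k = Max (Y ` {..N})"
      by (metis imageE)
    have Y_le: "Y i \<le> Y k" if "i \<le> N" for i
      unfolding k using that by (intro Max_ge) auto
    have "Y i \<le> Y k" for i
      using Y_le[of i] Y_le[of 0] large[of i] by linarith
    hence "(SUP i. ereal (Y i)) = ereal (Y k)"
      by (intro antisym SUP_least SUP_upper) auto
    thus ?case
      unfolding perturbed_max_def Y_def by blast
  qed
qed

end

theorem theorem3:
  fixes M :: "'a measure" and \<xi> X :: "nat \<Rightarrow> 'a \<Rightarrow> real" and d \<nu> :: real
  assumes "prob_space M"
    and "d > 0" and "\<nu> > 0"
    and "iid M UNIV \<xi>"
    and "\<And>j. (\<lambda>x. measure M {\<omega> \<in> space M. \<xi> j \<omega> > x}) \<sim>[at_top] (\<lambda>x. d * exp (- \<nu> * x))"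
    and "iid M {1..} X"
    and "indep_sequences M UNIV \<xi> {1..} X"
    and "integrable M (\<lambda>\<omega>. exp (\<nu> * X 1 \<omega>))"
    and "(\<integral>\<omega>. exp (\<nu> * X 1 \<omega>) \<partial>M) < 1"
  shows "(AE \<omega> in M. \<exists>k. perturbed_max X \<xi> \<omega> = ereal (walk X k \<omega> + \<xi> k \<omega>)) \<and>
    (\<lambda>x. measure M {\<omega> \<in> space M. perturbed_max X \<xi> \<omega> > ereal x}) \<sim>[at_top]
      (\<lambda>x. d * inverse (1 - (\<integral>\<omega>. exp (\<nu> * X 1 \<omega>) \<partial>M)) * exp (- \<nu> * x))"
proof -
  interpret prob_space M by fact
  interpret perturbed_walk M \<xi> X d \<nu>
    by unfold_locales (fact assms)+
  have "((\<lambda>x. prob {\<omega> \<in> space M. perturbed_max X \<xi> \<omega> > ereal x} / exp (- \<nu> * x)) \<longlongrightarrow>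
      d * inverse (1 - \<rho>)) at_top"
    using scaled_prob_perturbed_max_tendsto by (simp add: exp_minus field_simps)
  \<comment> \<open>A limit of the quotient gives an equivalence only if it is nonzero, which
    follows from \<open>d > 0\<close> and \<open>\<rho> < 1\<close>.\<close>
  hence "(\<lambda>x. prob {\<omega> \<in> space M. perturbed_max X \<xi> \<omega> > ereal x}) \<sim>[at_top]
      (\<lambda>x. d * inverse (1 - \<rho>) * exp (- \<nu> * x))"
    using assms(2,9) by (intro asymp_equivI'_const) (auto simp: \<rho>_def)
  thus ?thesis
    using AE_perturbed_max_attained by (simp add: \<rho>_def)
qed

end
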